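(* Let $I=\{B_1,\ldots,B_n\}$, $n\ge2$, be an implementable information structure, let $L(I)=\{G_1,\ldots,G_n\}$ with the labeling such that $c(G_1)<\cdots<c(G_n)$, and let $C=\{(p(G_1),\mathbb{E}_{\lambda_{G_1}}(X)),\ldots,(p(G_n),\mathbb{E}_{\lambda_{G_n}}(X))\}\in\varphi^P(I)$ be the menu induced by $I$. Consider the (implementable) information structure $I'=\{B_2,\ldots,B_n\}$ and let $$J=\left[\frac{p(G_1)}{\mathbb{E}_{\lambda_{G_1}}(X)},\ \frac{p(G_2)-p(G_1)}{\mathbb{E}_{\lambda_{G_2}}(X)-\mathbb{E}_{\lambda_{G_1}}(X)}\right].$$ Then $\pi^P(I)\le\pi^P(I')$ if $F(m)m$ is convex on $J$, and $\pi^P(I)\ge\pi^P(I')$ if $F(m)m$ is concave on $J$.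
   Context: Sellers and information. Sellers' quality levels lie in $X=[0,\overline{x}]$, $\overline{x}>0$, distributed according to a Borel probability measure $\phi$ on $X$. The platform's information is a finite measurable partition $I_o=\{A_1,\ldots,A_l\}$ of $X$ with $\phi(A_i)>0$. An information structure is a nonempty family $I=\{B_1,\ldots,B_n\}$ of pairwise disjoint nonempty sets, each a union of elements of $I_o$. $L(I)=\{G_1,\ldots,G_n\}$, where $G_j\in I_o$ is the element $A_k$ of lowest index $k$ among those contained in $B_j$. Sellers have a positive marginal cost $c(x)$, constant on each $A_i$ with value $c(A_i)$, and $c(A_i)<c(A_j)$ for $i<j$. Buyers. Types $m$ are distributed according to a continuous cumulative distribution function $F$ (on $\mathbb{R}$) supported on $[a,b]\subseteq[0,\infty)$, $a<b$ ($F$ strictly increasing on $[a,b]$). With beliefs $\lambda_{B_i}$ about quality in $B_i$ (mean $\mathbb{E}_{\lambda_{B_i}}(X)$) and $p(B_i)$ the lowest price in $B_i$, a type $m$ buyer's utility from buying in $B_i$ is $Z(m,B_i,p(B_i))=m\,\mathbb{E}_{\lambda_{B_i}}(X)-p(B_i)$, and $0$ from not buying. With $\boldsymbol{p}=(p(B_1),\ldots,p(B_n))$, the demand for $B_i$ is $D_I(B_i,\boldsymbol{p})=\int_a^b1\{Z(m,B_i,p(B_i))\ge0\}1\{Z(m,B_i,p(B_i))=\max_{B\in I}Z(m,B,p(B))\}F(dm)$. Sellers' game. Let $H(B_i)\subseteq B_i$ be the set of participating sellers and $M_I(B_i,\boldsymbol{p})$ the mass of sellers in $B_i$ charging $p(B_i)$.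 If the other sellers in $H(B_i)$ charge $p(B_i)$, a participating seller $x\in B_i$ charging $p_x\ge0$ sells quantity $h_I(B_i,H(B_i),p_x,\boldsymbol{p})$ equal to $\infty$ if $p_x<p(B_i)$ and $D_I(B_i,\boldsymbol{p})>0$; $D_I(B_i,\boldsymbol{p})/M_I(B_i,\boldsymbol{p})$ if $p_x=p(B_i)$ and $D_I(B_i,\boldsymbol{p})>0$ (interpreted as $\infty$ if $M_I(B_i,\boldsymbol p)=0$); and $0$ if $p_x>p(B_i)$ or $D_I(B_i,\boldsymbol{p})=0$. The seller's utility is $\overline{U}(x,H(B_i),p_x,\boldsymbol{p})=h_I(B_i,H(B_i),p_x,\boldsymbol{p})(p_x-c(x))$ (with $\infty\cdot0=0$); not participating gives $0$. Equilibrium. For $I$, a (symmetric) equilibrium consists of positive prices $\boldsymbol{p}$ (all participating sellers in $B_i$ charge $p(B_i)$), positive masses $M_I(B_i,\boldsymbol{p})=\phi(H(B_i))$, positive demands $D_I(B_i,\boldsymbol{p})$, and beliefs $\lambda_{B_i}$ such that: (1) $p(B_i)$ is a maximizer of $p_x\mapsto\overline{U}(x,H(B_i),p_x,\boldsymbol{p})$ over $p_x\ge0$ for each $x\in H(B_i)$, and $x\in B_i$ belongs to $H(B_i)$ if and only if $\overline{U}(x,H(B_i),p(B_i),\boldsymbol{p})\ge0$; (2) buyers' decisions are optimal, as reflected in $D_I$; (3) $\lambda_{B_i}(A)=\phi(A\cap H(B_i))/\phi(H(B_i))$ for every measurable $A$; (4) $M_I(B_i,\boldsymbol{p})\,h_I(B_i,H(B_i),p(B_i),\boldsymbol{p})=D_I(B_i,\boldsymbol{p})$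 for all $B_i\in I$. $I$ is implementable if an equilibrium under $I$ exists. In any equilibrium the menu $\{(p(B_i),\mathbb{E}_{\lambda_{B_i}}(X)):B_i\in I\}$ induced by $I$ equals $\{(c(G_i),\mathbb{E}_{\lambda_{G_i}}(X)):i=1,\ldots,n\}$ with $\lambda_{G_i}(A)=\phi(A\cap G_i)/\phi(G_i)$; one writes $p(G_i)=c(G_i)$ for the price of the $i$th pair, and $\varphi^P(I)$ is the set consisting of this menu. The platform's revenue is $\pi^P(I)=\sum_{B_i\in I}p(B_i)\min\{D_I(B_i,\boldsymbol{p}),\,M_I(B_i,\boldsymbol{p})h_I(B_i,H(B_i),p(B_i),\boldsymbol{p})\}$ evaluated at equilibrium. *)

theory Defs
  imports "HOL-Probability.Probability"
begin

text \<open>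
  The primitives. The platform's information is the partition
  \<open>cell 1, \<dots>, cell num_cells\<close> of \<open>[0, max_quality]\<close>; the cumulative distribution
  function of buyers' types is \<open>cdf type_dist\<close>.
\<close>

record market =
  max_quality :: real
  quality_dist :: "real measure"
  num_cells :: nat
  cell :: "nat \<Rightarrow> real set"
  cost :: "real \<Rightarrow> real"
  type_dist :: "real measure"
  type_min :: real
  type_max :: real

text \<open>The value of the cost function on a set on which it is constant.\<close>

definition cost_on :: "market \<Rightarrow> real set \<Rightarrow> real" where
  "cost_on mk A = the_elem (cost mk ` A)"

definition valid_market :: "market \<Rightarrow> bool" where
  "valid_market mk \<longleftrightarrow>
     0 < max_quality mk \<and>
     prob_space (quality_dist mk) \<and>
     sets (quality_dist mk) = sets (restrict_space borel {0..max_quality mk}) \<and>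
     (\<forall>i\<in>{1..num_cells mk}. cell mk i \<in> sets (quality_dist mk)
        \<and> 0 < measure (quality_dist mk) (cell mk i)) \<and>
     disjoint_family_on (cell mk) {1..num_cells mk} \<and>
     (\<Union>i\<in>{1..num_cells mk}. cell mk i) = {0..max_quality mk} \<and>
     (\<forall>x\<in>{0..max_quality mk}. 0 < cost mk x) \<and>
     (\<forall>i\<in>{1..num_cells mk}. \<forall>x\<in>cell mk i. cost mk x = cost_on mk (cell mk i)) \<and>
     strict_mono_on {1..num_cells mk} (\<lambda>i. cost_on mk (cell mk i)) \<and>
     real_distribution (type_dist mk) \<and>
     continuous_on UNIV (cdf (type_dist mk)) \<and>
     0 \<le> type_min mk \<and> type_min mk < type_max mk \<and>
     measure (type_dist mk) {type_min mk..type_max mk} = 1 \<and>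
     strict_mono_on {type_min mk..type_max mk} (cdf (type_dist mk))"

definition information_structure :: "market \<Rightarrow> real set set \<Rightarrow> bool" where
  "information_structure mk I \<longleftrightarrow>
     I \<noteq> {} \<and> {} \<notin> I \<and> disjoint I \<and>
     (\<forall>B\<in>I. \<exists>K\<subseteq>{1..num_cells mk}. B = (\<Union>k\<in>K. cell mk k))"

definition lowest_cell :: "market \<Rightarrow> real set \<Rightarrow> real set" where
  "lowest_cell mk B = cell mk (Min {k \<in> {1..num_cells mk}. cell mk k \<subseteq> B})"

definition mean :: "real measure \<Rightarrow> real" where
  "mean M = (\<integral>x. x \<partial>M)"

text \<open>
  The unknowns of the game. The values at sets outside the information structure
  under consideration are irrelevant.
\<close>

record outcome =
  price :: "real set \<Rightarrow> real"
  participants :: "real set \<Rightarrow> real set"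
  belief :: "real set \<Rightarrow> real measure"

definition buyer_utility :: "outcome \<Rightarrow> real \<Rightarrow> real set \<Rightarrow> real" where
  "buyer_utility E m B = m * mean (belief E B) - price E B"

definition demand :: "market \<Rightarrow> real set set \<Rightarrow> outcome \<Rightarrow> real set \<Rightarrow> real" where
  "demand mk I E B =
     (LINT m:{type_min mk..type_max mk}|type_dist mk.
        indicator {m. buyer_utility E m B \<ge> 0} m *
        indicator {m. buyer_utility E m B = (MAX B'\<in>I. buyer_utility E m B')} m)"

definition mass :: "market \<Rightarrow> outcome \<Rightarrow> real set \<Rightarrow> real" where
  "mass mk E B = measure (quality_dist mk) (participants E B)"

definition quantity ::
    "market \<Rightarrow> real set set \<Rightarrow> outcome \<Rightarrow> real set \<Rightarrow> real \<Rightarrow> ereal" where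
  "quantity mk I E B q =
     (if q < price E B \<and> 0 < demand mk I E B then \<infinity>
      else if q = price E B \<and> 0 < demand mk I E B then
        (if mass mk E B = 0 then \<infinity> else ereal (demand mk I E B / mass mk E B))
      else 0)"

definition seller_utility ::
    "market \<Rightarrow> real set set \<Rightarrow> outcome \<Rightarrow> real set \<Rightarrow> real \<Rightarrow> real \<Rightarrow> ereal" where
  "seller_utility mk I E B x q = quantity mk I E B q * ereal (q - cost mk x)"

text \<open>
  Optimality of buyers' decisions is built into \<^const>\<open>demand\<close>. For a set \<open>H\<close> of positive
  measure, \<open>uniform_measure \<phi> H\<close> is the conditional distribution
  \<open>A \<mapsto> \<phi> (A \<inter> H) / \<phi> H\<close>.
\<close>

definition equilibrium :: "market \<Rightarrow> real set set \<Rightarrow> outcome \<Rightarrow> bool" where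
  "equilibrium mk I E \<longleftrightarrow>
     (\<forall>B\<in>I.
        0 < price E B \<and>
        participants E B \<subseteq> B \<and>
        participants E B \<in> sets (quality_dist mk) \<and>
        0 < mass mk E B \<and>
        0 < demand mk I E B \<and>
        (\<forall>x\<in>participants E B. \<forall>q\<ge>0.
           seller_utility mk I E B x q \<le> seller_utility mk I E B x (price E B)) \<and>
        (\<forall>x\<in>B. x \<in> participants E B \<longleftrightarrow> 0 \<le> seller_utility mk I E B x (price E B)) \<and>
        belief E B = uniform_measure (quality_dist mk) (participants E B) \<and>
        ereal (mass mk E B) * quantity mk I E B (price E B) = ereal (demand mk I E B))"

definition implementable :: "market \<Rightarrow> real set set \<Rightarrow> bool" where
  "implementable mk I \<longleftrightarrow> information_structure mk I \<and> (\<exists>E. equilibrium mk I E)"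

definition induced_menus :: "market \<Rightarrow> real set set \<Rightarrow> (real \<times> real) set set" where
  "induced_menus mk I =
     {(\<lambda>B. (price E B, mean (belief E B))) ` I | E. equilibrium mk I E}"

definition revenue :: "market \<Rightarrow> real set set \<Rightarrow> outcome \<Rightarrow> ereal" where
  "revenue mk I E =
     (\<Sum>B\<in>I. ereal (price E B) *
        min (ereal (demand mk I E B))
            (ereal (mass mk E B) * quantity mk I E B (price E B)))"

end

theory Submission imports Defs begin

text \<open>
  In equilibrium undercutting forces every participant's cost to equal the price, so only the
  cheapest cell of each \<open>B\<close> trades, at its cost. Removing \<open>B\<^sub>1\<close> from the menu changes only the
  purchases of types between \<open>t\<^sub>1 = p\<^sub>1 / E\<^sub>1\<close> and \<open>t\<^sub>2 = (p\<^sub>2 - p\<^sub>1) / (E\<^sub>2 - E\<^sub>1)\<close>: types in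
  \<open>[t\<^sub>1, t\<^sub>2]\<close> bought \<open>B\<^sub>1\<close>, and those in \<open>[s, t\<^sub>2]\<close> with \<open>s = p\<^sub>2 / E\<^sub>2\<close> now buy \<open>B\<^sub>2\<close>. Since
  \<open>E\<^sub>2 s = E\<^sub>1 t\<^sub>1 + (E\<^sub>2 - E\<^sub>1) t\<^sub>2\<close>, the gain in revenue is
  \<open>E\<^sub>1 g(t\<^sub>1) + (E\<^sub>2 - E\<^sub>1) g(t\<^sub>2) - E\<^sub>2 g(s)\<close> with \<open>g(m) = F(m) m\<close>, a Jensen gap of \<open>g\<close>.
\<close>

section \<open>Buyers' choice sets and demand\<close>

text \<open>The index type is arbitrary, so options can be sets or menu positions. Types range over
  all reals: the type distribution puts no mass outside its range, and choice sets stay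
  closed.\<close>

definition choosers :: "('i \<Rightarrow> real) \<Rightarrow> ('i \<Rightarrow> real) \<Rightarrow> 'i set \<Rightarrow> 'i \<Rightarrow> real set" where
  "choosers p e T k = {m. 0 \<le> m * e k - p k \<and> (\<forall>j\<in>T. m * e j - p j \<le> m * e k - p k)}"

lemma closed_choosers: "closed (choosers p e T k)"
proof -
  have "choosers p e T k = {m. 0 \<le> m * e k - p k} \<inter>
      (\<Inter>j\<in>T. {m. m * e j - p j \<le> m * e k - p k})"
    by (auto simp: choosers_def)
  also have "closed \<dots>"
    by (intro closed_Int closed_INT ballI closed_Collect_le continuous_intros)
  finally show ?thesis .
qed

lemma AE_type_range:
  assumes mk: "valid_market mk"
  shows "AE m in type_dist mk. m \<in> {type_min mk..type_max mk}"
proof -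
  interpret D: real_distribution "type_dist mk"
    using mk by (simp add: valid_market_def)
  show ?thesis
    using mk by (intro D.AE_prob_1) (auto simp: valid_market_def)
qed

lemma demand_eq_measure_choosers:
  assumes mk: "valid_market mk" and I: "finite I" "B \<in> I"
  shows "demand mk I E B =
    measure (type_dist mk) (choosers (price E) (\<lambda>B. mean (belief E B)) I B)"
proof -
  interpret D: real_distribution "type_dist mk"
    using mk by (simp add: valid_market_def)
  let ?T = "{type_min mk..type_max mk}"
  define S where "S = choosers (price E) (\<lambda>B. mean (belief E B)) I B"
  have max_iff: "buyer_utility E m B = (MAX B'\<in>I. buyer_utility E m B') \<longleftrightarrow>
      (\<forall>B'\<in>I. buyer_utility E m B' \<le> buyer_utility E m B)" for m
    using I by (subst eq_commute, subst Max_eq_iff) auto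
  have meas: "S \<in> sets borel" "?T \<in> sets borel"
    unfolding S_def by (auto intro: borel_closed closed_choosers)
  have "demand mk I E B = (LINT m|type_dist mk. indicator (?T \<inter> S) m)"
    unfolding demand_def set_lebesgue_integral_def
    by (rule Bochner_Integration.integral_cong)
       (auto simp: S_def choosers_def indicator_def max_iff[unfolded buyer_utility_def]
         buyer_utility_def)
  also have "\<dots> = measure (type_dist mk) (?T \<inter> S)"
    using meas by simp
  also have "\<dots> = measure (type_dist mk) S"
    using AE_type_range[OF mk] meas by (intro D.finite_measure_eq_AE) auto
  finally show ?thesis unfolding S_def .
qed

text \<open>Turns positive demand into a concrete nonnegative buyer, whose preferences later yield
  inequalities between means.\<close>

lemma nonneg_chooser_exists:
  assumes mk: "valid_market mk" and pos: "0 < measure (type_dist mk) (choosers p e T k)"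
  shows "\<exists>m\<ge>0. m \<in> choosers p e T k"
proof (rule ccontr)
  assume neg: "\<not> (\<exists>m\<ge>0. m \<in> choosers p e T k)"
  interpret D: real_distribution "type_dist mk"
    using mk by (simp add: valid_market_def)
  have "0 \<le> type_min mk" using mk by (simp add: valid_market_def)
  with neg have "AE m in type_dist mk. m \<notin> choosers p e T k"
    using AE_type_range[OF mk] by (auto elim!: eventually_mono)
  then have "measure (type_dist mk) (choosers p e T k) = 0"
    by (subst D.prob_eq_0) (auto intro: borel_closed closed_choosers)
  with pos show False by simp
qed

section \<open>Cheapest cells and equilibrium prices\<close>

text \<open>Cost is strictly increasing in the cell index, so the cell of least index in
  \<open>B\<close> collects all the cost minimisers, and no other cell shares its cost.\<close>

lemma lowest_cell_minimal_cost:
  assumes mk: "valid_market mk" and I: "information_structure mk I" and B: "B \<in> I"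
  shows "lowest_cell mk B = {x \<in> B. cost mk x = cost_on mk (lowest_cell mk B)}"
    and "\<And>x. x \<in> B \<Longrightarrow> cost_on mk (lowest_cell mk B) \<le> cost mk x"
    and "\<And>x. x \<in> B \<Longrightarrow> 0 < cost mk x"
    and "lowest_cell mk B \<noteq> {}"
proof -
  define N where "N = {1..num_cells mk}"
  define L where "L = {k \<in> N. cell mk k \<subseteq> B}"
  obtain K where K: "K \<subseteq> N" "B = (\<Union>k\<in>K. cell mk k)"
    using I B unfolding information_structure_def N_def by blast
  have "B \<noteq> {}" using I B by (auto simp: information_structure_def)
  have KL: "K \<subseteq> L" using K by (auto simp: L_def)
  have fin: "finite L" by (simp add: L_def N_def)
  have L: "L \<noteq> {}" using KL K(2) \<open>B \<noteq> {}\<close> by auto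
  have low: "lowest_cell mk B = cell mk (Min L)"
    by (simp add: lowest_cell_def L_def N_def)
  have minL: "Min L \<in> L" using fin L by (rule Min_in)
  have cost_cell: "cost mk x = cost_on mk (cell mk k)" if "k \<in> N" "x \<in> cell mk k" for k x
    using mk that by (auto simp: valid_market_def N_def)
  have mono: "strict_mono_on N (\<lambda>k. cost_on mk (cell mk k))"
    using mk by (simp add: valid_market_def N_def)
  have ex: "\<exists>k\<in>L. x \<in> cell mk k" if "x \<in> B" for x
    using that K KL by auto
  have LN: "L \<subseteq> N" by (auto simp: L_def)
  have le: "cost_on mk (cell mk (Min L)) \<le> cost_on mk (cell mk k)" if "k \<in> L" for k
    using strict_mono_on_leD[OF mono] Min_le[OF fin that] minL that LN by blast
  show "\<And>x. x \<in> B \<Longrightarrow> cost_on mk (lowest_cell mk B) \<le> cost mk x"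
    using ex le cost_cell LN unfolding low by force
  show "\<And>x. x \<in> B \<Longrightarrow> 0 < cost mk x"
  proof -
    fix x assume "x \<in> B"
    then have "x \<in> (\<Union>k\<in>N. cell mk k)" using ex LN by blast
    moreover have "(\<Union>k\<in>N. cell mk k) = {0..max_quality mk}" "\<forall>x\<in>{0..max_quality mk}. 0 < cost mk x"
      using mk by (simp_all add: valid_market_def N_def)
    ultimately show "0 < cost mk x" by blast
  qed
  have "0 < measure (quality_dist mk) (cell mk (Min L))"
    using minL LN mk by (auto simp: valid_market_def N_def)
  then show "lowest_cell mk B \<noteq> {}" unfolding low by auto
  have "x \<in> cell mk (Min L)" if x: "x \<in> B" "cost mk x = cost_on mk (cell mk (Min L))" for x
  proof -
    obtain k where k: "k \<in> L" "x \<in> cell mk k" using ex x by blast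
    then have "cost_on mk (cell mk k) = cost_on mk (cell mk (Min L))"
      using cost_cell LN x by auto
    then have "k = Min L"
      using strict_mono_on_eqD[OF mono] k minL LN by blast
    with k show ?thesis by simp
  qed
  moreover have "cell mk (Min L) \<subseteq> B" using minL by (simp add: L_def)
  ultimately show "lowest_cell mk B = {x \<in> B. cost mk x = cost_on mk (lowest_cell mk B)}"
    unfolding low using cost_cell minL LN by blast
qed

lemma information_structure_subset:
  assumes I: "information_structure mk I" and J: "J \<subseteq> I" "J \<noteq> {}"
  shows "information_structure mk J"
proof -
  have "disjoint J"
    using I J(1) by (auto simp: information_structure_def intro: pairwise_subset)
  moreover have "{} \<notin> J"
    using I J(1) by (auto simp: information_structure_def)
  ultimately show ?thesis
    using I J by (simp add: information_structure_def subset_iff)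
qed

lemma seller_utility_nonneg_iff:
  assumes "0 < demand mk I E B" "0 < mass mk E B"
  shows "0 \<le> seller_utility mk I E B x (price E B) \<longleftrightarrow> cost mk x \<le> price E B"
proof -
  have "seller_utility mk I E B x (price E B) =
      ereal (demand mk I E B / mass mk E B * (price E B - cost mk x))"
    using assms by (simp add: seller_utility_def quantity_def)
  moreover have "0 < demand mk I E B / mass mk E B" using assms by simp
  ultimately show ?thesis
    by (simp only: ereal_less_eq zero_le_mult_iff) auto
qed

lemma equilibrium_participants:
  assumes mk: "valid_market mk" and I: "information_structure mk I"
    and E: "equilibrium mk I E" and B: "B \<in> I"
  shows "participants E B = lowest_cell mk B" and "price E B = cost_on mk (lowest_cell mk B)"
proof -
  note low = lowest_cell_minimal_cost[OF mk I B]
  have D: "0 < demand mk I E B" "0 < mass mk E B" "participants E B \<subseteq> B"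
    using E B by (auto simp: equilibrium_def)
  have H: "x \<in> participants E B \<longleftrightarrow> cost mk x \<le> price E B" if "x \<in> B" for x
    using E B that seller_utility_nonneg_iff[OF D(1,2)] by (auto simp: equilibrium_def)
  have ge: "price E B \<le> cost mk x" if x: "x \<in> participants E B" for x
  proof (rule ccontr)
    assume less: "\<not> price E B \<le> cost mk x"
    \<comment> \<open>At the midpoint the margin is still positive and sales are infinite, so
      undercutting beats the finite utility at the posted price.\<close>
    define q where "q = (cost mk x + price E B) / 2"
    have q: "0 \<le> q" "q < price E B" "cost mk x < q"
      using less low(3)[of x] D(3) x by (auto simp: q_def)
    have "seller_utility mk I E B x q \<le> seller_utility mk I E B x (price E B)"
      using E B x q by (auto simp: equilibrium_def)
    then show False
      using D q by (simp add: seller_utility_def quantity_def)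
  qed
  have "participants E B \<noteq> {}" using D(2) by (auto simp: mass_def)
  then obtain x where x: "x \<in> participants E B" by blast
  have cx: "cost mk x = price E B" using x H ge D(3) by force
  obtain y where y: "y \<in> B" "cost mk y = cost_on mk (lowest_cell mk B)"
    using low(1,4) by blast
  \<comment> \<open>A cheapest seller \<open>y\<close> costs no more than the participant
    \<open>x\<close>, hence participates too, and \<open>ge\<close> then forces the price down to
    the cost of \<open>y\<close>.\<close>
  have "cost mk y \<le> price E B" using low(2)[of x] x D(3) cx y by auto
  then have "price E B \<le> cost mk y" using ge H y by blast
  with \<open>cost mk y \<le> price E B\<close> y show pr: "price E B = cost_on mk (lowest_cell mk B)" by simp
  show "participants E B = lowest_cell mk B"
    using H ge D(3) unfolding pr by (subst low(1)) (auto intro: antisym)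
qed

section \<open>Removing sets: equilibria, revenue and choices\<close>

text \<open>The same outcome survives: fewer rivals only raise demand, and participation depends
  only on cost against price. Margins are zero, so a lower price loses infinitely much and a higher
  one sells nothing.\<close>

lemma equilibrium_subset:
  assumes mk: "valid_market mk" and I: "information_structure mk I" "finite I"
    and E: "equilibrium mk I E" and sub: "J \<subseteq> I"
  shows "equilibrium mk J E"
  unfolding equilibrium_def
proof (intro ballI)
  fix B assume "B \<in> J"
  then have B: "B \<in> I" using sub by blast
  interpret D: real_distribution "type_dist mk"
    using mk by (simp add: valid_market_def)
  have eq: "0 < price E B" "participants E B \<subseteq> B" "participants E B \<in> sets (quality_dist mk)"
      "0 < mass mk E B" "0 < demand mk I E B"
      "belief E B = uniform_measure (quality_dist mk) (participants E B)"
      "\<forall>x\<in>B. x \<in> participants E B \<longleftrightarrow> 0 \<le> seller_utility mk I E B x (price E B)"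
    using E B by (auto simp: equilibrium_def)
  have finJ: "finite J" using I(2) sub by (rule finite_subset[rotated])
  have "choosers p e I B \<subseteq> choosers p e J B" for p e
    using sub by (auto simp: choosers_def)
  then have "demand mk I E B \<le> demand mk J E B"
    using B \<open>B \<in> J\<close> I finJ mk
    by (auto simp: demand_eq_measure_choosers
        intro!: D.finite_measure_mono borel_closed closed_choosers)
  with eq have pos: "0 < demand mk J E B" by simp
  note nn = seller_utility_nonneg_iff[OF eq(5,4)] seller_utility_nonneg_iff[OF pos eq(4)]
  have "cost mk x = price E B" if "x \<in> participants E B" for x
    using lowest_cell_minimal_cost(1)[OF mk I(1) B] equilibrium_participants[OF mk I(1) E B] that
    by auto
  then have "seller_utility mk J E B x q \<le> seller_utility mk J E B x (price E B)"
    if "x \<in> participants E B" for x q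
    using that pos eq(4) by (auto simp: seller_utility_def quantity_def)
  then show "0 < price E B \<and> participants E B \<subseteq> B \<and>
        participants E B \<in> sets (quality_dist mk) \<and>
        0 < mass mk E B \<and> 0 < demand mk J E B \<and>
        (\<forall>x\<in>participants E B. \<forall>q\<ge>0.
           seller_utility mk J E B x q \<le> seller_utility mk J E B x (price E B)) \<and>
        (\<forall>x\<in>B. x \<in> participants E B \<longleftrightarrow> 0 \<le> seller_utility mk J E B x (price E B)) \<and>
        belief E B = uniform_measure (quality_dist mk) (participants E B) \<and>
        ereal (mass mk E B) * quantity mk J E B (price E B) = ereal (demand mk J E B)"
    using eq pos nn by (simp add: quantity_def)
qed

text \<open>Market clearing makes the two arguments of \<open>min\<close> equal.\<close>

lemma equilibrium_revenue:
  assumes "equilibrium mk I E"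
  shows "revenue mk I E = ereal (\<Sum>B\<in>I. price E B * demand mk I E B)"
  unfolding revenue_def sum_ereal[symmetric]
  using assms by (intro sum.cong) (simp_all add: equilibrium_def)

text \<open>
  The witness \<open>m0\<close> buys \<open>2\<close> from the full menu, which orders the switching points so that no
  \<open>k > 2\<close> interferes with the choice between \<open>1\<close> and \<open>2\<close>.
\<close>

lemma choosers_remove_cheapest:
  fixes p e :: "nat \<Rightarrow> real" and n :: nat
  assumes n: "2 \<le> n" and e1: "0 < e 1" and e: "strict_mono_on {1..n} e"
    and m0: "m0 \<in> choosers p e {1..n} 2"
  defines "t \<equiv> (p 2 - p 1) / (e 2 - e 1)"
  shows "choosers p e {1..n} 1 = {p 1 / e 1..t}"
    and "choosers p e {2..n} 2 = choosers p e {1..n} 2 \<union> {p 2 / e 2..<t}"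
    and "choosers p e {1..n} 2 \<inter> {p 2 / e 2..<t} = {}"
    and "\<And>k. k \<in> {3..n} \<Longrightarrow> choosers p e {2..n} k = choosers p e {1..n} k"
proof -
  define u where "u k m = m * e k - p k" for k m
  have S_def: "choosers p e T k = {m. 0 \<le> u k m \<and> (\<forall>j\<in>T. u j m \<le> u k m)}" for T k
    by (simp add: choosers_def u_def)
  have split: "{1..n} = insert 1 (insert 2 {3..n})" "{2..n} = insert 2 {3..n}" using n by auto
  have e12: "e 1 < e 2" using strict_mono_onD[OF e, of 1 2] n by auto
  have e2k: "e 2 < e k" if "k \<in> {3..n}" for k
    using strict_mono_onD[OF e, of 2 k] that by auto
  have u0: "0 \<le> u 1 m \<longleftrightarrow> p 1 / e 1 \<le> m" "0 \<le> u 2 m \<longleftrightarrow> p 2 / e 2 \<le> m" for m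
    using e1 e12 by (auto simp: u_def pos_divide_le_eq)
  have u12: "u 1 m \<le> u 2 m \<longleftrightarrow> t \<le> m" "u 2 m \<le> u 1 m \<longleftrightarrow> m \<le> t" for m
    using e12 by (auto simp: u_def t_def pos_divide_le_eq pos_le_divide_eq algebra_simps)
  have "u 1 m0 \<le> u 2 m0" using m0 n by (auto simp: S_def)
  then have tm0: "t \<le> m0" by (simp only: u12)
  \<comment> \<open>The advantage of \<open>k\<close> over \<open>2\<close> is affine in the type
    with positive slope, and it is nonpositive at \<open>m0\<close>. So left of \<open>m0\<close>,
    in particular up to \<open>t\<close>, option \<open>2\<close> is at least as good as
    \<open>k\<close>.\<close>
  have cross: "(u k m - u 2 m) - (u k m0 - u 2 m0) = (m - m0) * (e k - e 2)" for k m
    by (simp add: u_def algebra_simps)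
  have m0k: "u k m0 \<le> u 2 m0" if "k \<in> {3..n}" for k
    using m0 that by (auto simp: S_def)
  have below: "u k m \<le> u 2 m" if "k \<in> {3..n}" "m \<le> t" for k m
    using mult_nonpos_nonneg[of "m - m0" "e k - e 2"] cross[of k m] e2k[of k] m0k[of k] that tm0
    by simp
  \<comment> \<open>A type that weakly prefers \<open>k\<close> to \<open>2\<close> therefore also
    weakly prefers \<open>2\<close> to \<open>1\<close>, so option \<open>1\<close> does not
    constrain the choice of \<open>k\<close>.\<close>
  have above: "t \<le> m" if "k \<in> {3..n}" "u 2 m \<le> u k m" for k m
  proof (rule ccontr)
    assume "\<not> t \<le> m"
    then show False
      using mult_neg_pos[of "m - m0" "e k - e 2"] cross[of k m] e2k[of k] m0k[of k] that tm0
      by simp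
  qed
  have "u k m \<le> u 1 m" if "k \<in> {3..n}" "m \<le> t" for k m
    using order_trans[OF below[OF that], of "u 1 m"] u12(2) that(2) by blast
  then show "choosers p e {1..n} 1 = {p 1 / e 1..t}"
    unfolding S_def split using u0 u12 by auto
  \<comment> \<open>Type \<open>t\<close> is indifferent between \<open>1\<close> and
    \<open>2\<close>; leaving it out of the interval keeps the union disjoint.\<close>
  show "choosers p e {2..n} 2 = choosers p e {1..n} 2 \<union> {p 2 / e 2..<t}"
    unfolding S_def split using u0 u12 below by (auto simp: not_le[symmetric])
  show "choosers p e {1..n} 2 \<inter> {p 2 / e 2..<t} = {}"
    unfolding S_def split using u12 by auto
  show "choosers p e {2..n} k = choosers p e {1..n} k" if "k \<in> {3..n}" for k
    unfolding S_def split using above[OF that] u12 by (auto intro: order_trans)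
qed

text \<open>Jensen's inequality multiplied by the total weight, to match the unnormalised weights in
  the revenue difference.\<close>

lemma convex_on_weighted_mean:
  fixes f :: "real \<Rightarrow> real"
  assumes "convex_on A f" "x \<in> A" "y \<in> A" "0 < a" "0 < b"
  shows "(a + b) * f ((a * x + b * y) / (a + b)) \<le> a * f x + b * f y"
proof -
  have "a / (a + b) + b / (a + b) = 1"
    using assms by (simp add: add_divide_distrib[symmetric])
  then have "f ((a / (a + b)) *\<^sub>R x + (b / (a + b)) *\<^sub>R y)
      \<le> a / (a + b) * f x + b / (a + b) * f y"
    using assms unfolding convex_on_def by (metis add_pos_pos divide_nonneg_pos less_imp_le)
  then have "f ((a * x + b * y) / (a + b)) \<le> (a * f x + b * f y) / (a + b)"
    by (simp add: add_divide_distrib)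
  then show ?thesis
    using assms by (simp add: pos_le_divide_eq mult.commute)
qed

text \<open>Here \<open>p\<close> and \<open>e\<close> are read off the cells alone, so all
  equilibria give the same revenue. This allows independent equilibria in the two structures to be
  compared.\<close>

lemma equilibrium_menu:
  assumes mk: "valid_market mk" and I: "information_structure mk (B ` X)"
    and E: "equilibrium mk (B ` X) E" and X: "finite X" "inj_on B X"
    and p: "\<And>i. i \<in> X \<Longrightarrow> p i = cost_on mk (lowest_cell mk (B i))"
    and e: "\<And>i. i \<in> X \<Longrightarrow> e i = mean (uniform_measure (quality_dist mk) (lowest_cell mk (B i)))"
  shows "\<And>i. i \<in> X \<Longrightarrow> price E (B i) = p i"
    and "\<And>i. i \<in> X \<Longrightarrow> mean (belief E (B i)) = e i"
    and "\<And>i. i \<in> X \<Longrightarrow> 0 < p i"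
    and "\<And>i. i \<in> X \<Longrightarrow> 0 < measure (type_dist mk) (choosers p e X i)"
    and "revenue mk (B ` X) E =
      ereal (\<Sum>i\<in>X. p i * measure (type_dist mk) (choosers p e X i))"
proof -
  show price: "price E (B i) = p i" if "i \<in> X" for i
    using equilibrium_participants(2)[OF mk I E] p that by simp
  show mean: "mean (belief E (B i)) = e i" if "i \<in> X" for i
    using equilibrium_participants(1)[OF mk I E] E e that by (simp add: equilibrium_def)
  have demand: "demand mk (B ` X) E (B i) = measure (type_dist mk) (choosers p e X i)"
    if "i \<in> X" for i
  proof -
    have "choosers (price E) (\<lambda>B. mean (belief E B)) (B ` X) (B i) = choosers p e X i"
      using that by (simp add: choosers_def price mean cong: ball_cong)
    then show ?thesis using demand_eq_measure_choosers[OF mk] X that by simp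
  qed
  show "0 < p i" if "i \<in> X" for i
    using E that price[OF that] by (auto simp: equilibrium_def)
  show "0 < measure (type_dist mk) (choosers p e X i)" if "i \<in> X" for i
    using E that demand[OF that] by (auto simp: equilibrium_def)
  show "revenue mk (B ` X) E =
      ereal (\<Sum>i\<in>X. p i * measure (type_dist mk) (choosers p e X i))"
    using X by (simp add: equilibrium_revenue[OF E] sum.reindex price demand)
qed

theorem corollary4:
  fixes mk :: market and n :: nat and B G :: "nat \<Rightarrow> real set"
    and I I' :: "real set set" and pG EG :: "nat \<Rightarrow> real"
    and C :: "(real \<times> real) set" and J :: "real set"
  assumes "valid_market mk"
    and "n \<ge> 2"
    and "I = B ` {1..n}"
    and "implementable mk I"
    and "\<And>i. i \<in> {1..n} \<Longrightarrow> G i = lowest_cell mk (B i)"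
    and "strict_mono_on {1..n} (\<lambda>i. cost_on mk (G i))"
    and "\<And>i. i \<in> {1..n} \<Longrightarrow> pG i = cost_on mk (G i)"
    and "\<And>i. i \<in> {1..n} \<Longrightarrow> EG i = mean (uniform_measure (quality_dist mk) (G i))"
    and "C = (\<lambda>i. (pG i, EG i)) ` {1..n}"
    and "I' = B ` {2..n}"
    and "J = {pG 1 / EG 1 .. (pG 2 - pG 1) / (EG 2 - EG 1)}"
  shows "C \<in> induced_menus mk I \<and> implementable mk I' \<and>
    (convex_on J (\<lambda>m. cdf (type_dist mk) m * m) \<longrightarrow>
       (\<forall>E E'. equilibrium mk I E \<longrightarrow> equilibrium mk I' E' \<longrightarrow>
          revenue mk I E \<le> revenue mk I' E')) \<and>
    (concave_on J (\<lambda>m. cdf (type_dist mk) m * m) \<longrightarrow>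
       (\<forall>E E'. equilibrium mk I E \<longrightarrow> equilibrium mk I' E' \<longrightarrow>
          revenue mk I E \<ge> revenue mk I' E'))"
proof -
  note mk = assms(1) and n = assms(2)
  \<comment> \<open>The lowest cells have distinct costs, so distinct labels name distinct
    sets.\<close>
  have inj: "inj_on B {1..n}"
  proof (rule inj_onI)
    fix i j assume ij: "i \<in> {1..n}" "j \<in> {1..n}" "B i = B j"
    then have "G i = G j" using assms(5) by simp
    then show "i = j" using strict_mono_on_eqD[OF assms(6)] ij by simp
  qed
  have I: "information_structure mk (B ` {1..n})" and "\<exists>E. equilibrium mk (B ` {1..n}) E"
    using assms(3,4) by (auto simp: implementable_def)
  then obtain E0 where E0: "equilibrium mk (B ` {1..n}) E0" by blast
  have sub: "{2..n} \<subseteq> {1..n}" "B ` {2..n} \<subseteq> B ` {1..n}" by auto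
  have I': "information_structure mk (B ` {2..n})"
    using information_structure_subset[OF I sub(2)] n by simp
  have E0': "equilibrium mk (B ` {2..n}) E0"
    using mk I _ E0 sub(2) by (rule equilibrium_subset) simp
  have pG: "pG i = cost_on mk (lowest_cell mk (B i))"
    and EG: "EG i = mean (uniform_measure (quality_dist mk) (lowest_cell mk (B i)))"
    if "i \<in> {1..n}" for i
    using assms(5,7,8) that by auto
  have inj': "inj_on B {2..n}" using inj sub(1) by (rule inj_on_subset)
  note menu = equilibrium_menu[OF mk I _ finite_atLeastAtMost inj pG EG]
  have pG': "pG i = cost_on mk (lowest_cell mk (B i))"
    and EG': "EG i = mean (uniform_measure (quality_dist mk) (lowest_cell mk (B i)))"
    if "i \<in> {2..n}" for i
    using pG EG that by auto
  note menu' = equilibrium_menu[OF mk I' _ finite_atLeastAtMost inj' pG' EG']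
  have C: "C \<in> induced_menus mk I"
    unfolding induced_menus_def assms(3,9)
    using E0 menu(1,2)[OF E0] by (auto simp: image_image intro!: exI[of _ E0])
  have impl: "implementable mk I'"
    using I' E0' assms(10) by (auto simp: implementable_def)

  \<comment> \<open>Order of the means and of the switching points\<close>
  interpret D: real_distribution "type_dist mk"
    using mk by (simp add: valid_market_def)
  let ?P = "measure (type_dist mk)" and ?F = "cdf (type_dist mk)"
  have p_pos: "0 < pG i" if "i \<in> {1..n}" for i
    using menu(3)[OF E0] that by simp
  have p_mono: "pG i < pG j" if "i \<in> {1..n}" "j \<in> {1..n}" "i < j" for i j
    using strict_mono_onD[OF assms(6) that] assms(7) that by simp
  have ex: "\<exists>m\<ge>0. m \<in> choosers pG EG {1..n} i" if "i \<in> {1..n}" for i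
    using nonneg_chooser_exists[OF mk menu(4)[OF E0]] that by simp
  \<comment> \<open>Some nonnegative type accepts the dearer option \<open>j\<close> over
    \<open>i\<close>, which requires a strictly higher mean.\<close>
  have e_mono: "strict_mono_on {1..n} EG"
  proof (rule strict_mono_onI)
    fix i j assume ij: "i \<in> {1..n}" "j \<in> {1..n}" "i < j"
    obtain m where m: "0 \<le> m" "m \<in> choosers pG EG {1..n} j" using ex ij by blast
    then have "m * EG i - pG i \<le> m * EG j - pG j" using ij by (auto simp: choosers_def)
    with p_mono[OF ij] have "m * EG i < m * EG j" by simp
    with m(1) show "EG i < EG j" by (simp add: mult_less_cancel_left)
  qed
  have e1: "0 < EG 1"
  proof -
    obtain m where "0 \<le> m" "m \<in> choosers pG EG {1..n} 1" using ex[of 1] n by auto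
    then have "0 < m * EG 1" "0 \<le> m" using p_pos[of 1] n by (auto simp: choosers_def)
    then show ?thesis by (simp add: zero_less_mult_iff)
  qed
  have e12: "EG 1 < EG 2" using strict_mono_onD[OF e_mono, of 1 2] n by simp

  define t1 t2 s where "t1 = pG 1 / EG 1" and "t2 = (pG 2 - pG 1) / (EG 2 - EG 1)"
    and "s = pG 2 / EG 2"
  obtain m0 where "m0 \<in> choosers pG EG {1..n} 2" using ex[of 2] n by auto
  note ch = choosers_remove_cheapest[OF n e1 e_mono this, folded t1_def t2_def s_def]
  \<comment> \<open>The choice set of option \<open>1\<close> is the interval from \<open>t1\<close>
    to \<open>t2\<close>, and it has a member.\<close>
  have t12: "t1 \<le> t2"
    using ex[of 1] n ch(1) by auto
  have price: "pG 1 = EG 1 * t1" "pG 2 - pG 1 = (EG 2 - EG 1) * t2" "pG 2 = EG 2 * s"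
    using e1 e12 by (simp_all add: t1_def t2_def s_def)
  have s_mean: "s = (EG 1 * t1 + (EG 2 - EG 1) * t2) / (EG 1 + (EG 2 - EG 1))"
    unfolding price(1,2)[symmetric] by (simp add: s_def)
  have st2: "s \<le> t2"
  proof -
    have "EG 2 * (t2 - s) = EG 1 * (t2 - t1)"
      using price by (simp add: algebra_simps)
    moreover have "0 \<le> EG 1 * (t2 - t1)" using t12 e1 by simp
    ultimately have "0 \<le> EG 2 * (t2 - s)" by (simp only:)
    then show ?thesis using e1 e12 by (simp add: zero_le_mult_iff)
  qed
  \<comment> \<open>Continuity of the cdf excludes atoms, so endpoints and indifferent types carry
    no mass.\<close>
  have atom: "?P {x} = 0" for x
    using mk D.isCont_cdf[of x] by (auto simp: valid_market_def continuous_on_eq_continuous_at)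
  have Ioc: "?P {x<..y} = ?F y - ?F x" if "x \<le> y" for x y
    using that by (cases "x = y") (auto simp: D.cdf_diff_eq)
  have Icc: "?P {x..y} = ?F y - ?F x" if "x \<le> y" for x y
  proof -
    have "{x..y} = {x} \<union> {x<..y}" using that by auto
    then show ?thesis using D.finite_measure_Union[of "{x}" "{x<..y}"] Ioc[OF that] atom by auto
  qed
  have Ico: "?P {x..<y} = ?F y - ?F x" if "x \<le> y" for x y
  proof -
    have "{x..y} = {x..<y} \<union> {y}" using that by auto
    then show ?thesis using D.finite_measure_Union[of "{x..<y}" "{y}"] Icc[OF that] atom by auto
  qed

  \<comment> \<open>The revenue difference and its sign\<close>
  define R R' where "R = (\<Sum>i\<in>{1..n}. pG i * ?P (choosers pG EG {1..n} i))"
    and "R' = (\<Sum>i\<in>{2..n}. pG i * ?P (choosers pG EG {2..n} i))"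
  have rev: "revenue mk I E = ereal R" "revenue mk I' E' = ereal R'"
    if "equilibrium mk I E" "equilibrium mk I' E'" for E E'
    using menu(5)[of E] menu'(5)[of E'] that assms(3,10) by (simp_all add: R_def R'_def)
  have split: "{1..n} = insert 1 (insert 2 {3..n})" "{2..n} = insert 2 {3..n}" using n by auto
  have D1: "?P (choosers pG EG {1..n} 1) = ?F t2 - ?F t1"
    using Icc[OF t12] ch(1) by simp
  have D2: "?P (choosers pG EG {2..n} 2) = ?P (choosers pG EG {1..n} 2) + (?F t2 - ?F s)"
    unfolding ch(2) using ch(3) Ico[OF st2]
    by (subst D.finite_measure_Union) (auto intro: borel_closed closed_choosers)
  have "R = pG 1 * ?P (choosers pG EG {1..n} 1) + pG 2 * ?P (choosers pG EG {1..n} 2)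
      + (\<Sum>i\<in>{3..n}. pG i * ?P (choosers pG EG {1..n} i))"
    unfolding R_def by (subst (1) split(1)) simp
  moreover have "R' = pG 2 * ?P (choosers pG EG {2..n} 2)
      + (\<Sum>i\<in>{3..n}. pG i * ?P (choosers pG EG {1..n} i))"
    unfolding R'_def by (subst (1) split(2)) (simp add: ch(4))
  ultimately have "R' - R = pG 2 * (?F t2 - ?F s) - pG 1 * (?F t2 - ?F t1)"
    unfolding D1 D2 by (simp add: algebra_simps)
  also have "\<dots> = pG 1 * ?F t1 + (pG 2 - pG 1) * ?F t2 - pG 2 * ?F s"
    by (simp add: algebra_simps)
  \<comment> \<open>Each price coefficient is a mean, or a difference of means, times the switching
    point at which \<open>?F\<close> is evaluated; this produces the values of
    \<open>?F m * m\<close>.\<close>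
  finally have gap: "R' - R = EG 1 * (?F t1 * t1) + (EG 2 - EG 1) * (?F t2 * t2)
      - (EG 1 + (EG 2 - EG 1)) * (?F s * s)"
    unfolding price(2) unfolding price(1,3) by simp
  have J: "t1 \<in> J" "t2 \<in> J" using t12 by (auto simp: assms(11) t1_def t2_def)
  have "R \<le> R'" if "convex_on J (\<lambda>m. ?F m * m)"
    using convex_on_weighted_mean[OF that J, of "EG 1" "EG 2 - EG 1"] e1 e12 gap
    unfolding s_mean[symmetric] by simp
  \<comment> \<open>Concavity is convexity of the negated function, so the same inequality applies
    with its sign reversed.\<close>
  moreover have "R' \<le> R" if "concave_on J (\<lambda>m. ?F m * m)"
    using convex_on_weighted_mean[OF that[unfolded concave_on_def] J, of "EG 1" "EG 2 - EG 1"]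
      e1 e12 gap
    unfolding s_mean[symmetric] by simp
  ultimately show ?thesis using C impl rev by simp
qed

end
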